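(* Let $n>1$ and let $\mathcal{C}_1$ be the tensor category of finite dimensional right comodules over $\Bbbk\mathcal{Z}(1)$ (the Hopf algebra $\Bbbk\mathcal{Z}(q)$ with $q=1$), with its objects $V(i,l)$, $i\in\mathbb{Z}_n$, $l\ge 0$. Then for all integers $l,m\ge 0$ there is an isomorphism in $\mathcal{C}_1$ $$V(0,l)\otimes V(0,m)\cong\begin{cases}\bigoplus_{i=0}^{l}V(i,l+m-2i), & l\le m;\\ \bigoplus_{i=0}^{m}V(i,l+m-2i), & l>m.\end{cases}$$
   Context: $\Bbbk$ is an algebraically closed field of characteristic $0$; $n>1$ is an integer; $\mathbb{Z}_n$ denotes the integers modulo $n$. For $q\in\Bbbk$ and integers $l,m\ge 0$ put $l_q=1+q+\cdots+q^{l-1}$, $l!_q=1_q\cdots l_q$, and let $\binom{l+m}{l}_q=\frac{(l+m)!_q}{l!_q\,m!_q}$ be the Gaussian binomial coefficient (a polynomial in $q$, evaluated at $q$). For $q\in\Bbbk$ with $q^n=1$, $\Bbbk\mathcal{Z}(q)$ is the Hopf algebra with $\Bbbk$-basis $\{p_i^l\mid i\in\mathbb{Z}_n,\ l\ge 0\}$ ($p_i^l$ is the path of length $l$ starting at vertex $i$ of the cyclic quiver with $n$ vertices), comultiplication $\Delta(p_i^l)=\sum_{j=0}^{l}p_{i+j}^{l-j}\otimes p_i^{j}$, counit $\varepsilon(p_i^l)=\delta_{l,0}$, multiplication $p_i^l\cdot p_j^m=q^{im}\binom{l+m}{l}_q\,p_{i+j}^{l+m}$, and unit $p_0^0$. $\mathcal{C}_q$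 is the tensor category of finite dimensional right $\Bbbk\mathcal{Z}(q)$-comodules, where the comodule structure of $U\otimes V$ is $u\otimes v\mapsto u_0\otimes v_0\otimes u_1v_1$ (Sweedler notation). For $i\in\mathbb{Z}_n$ and $l\ge 0$, $V(i,l)$ is the right $\Bbbk\mathcal{Z}(q)$-comodule with basis $v^i_0,\dots,v^i_l$ and coaction $v^i_m\mapsto\sum_{j=m}^{l}v^i_j\otimes p_{i+m}^{j-m}$. The first index of $V(i,l)$ is read modulo $n$. *)

theory Defs
  imports
    Complex_Main
    "HOL-Library.Poly_Mapping"
    "HOL-Computational_Algebra.Polynomial"
begin

section \<open>Vector spaces with a basis\<close>

text \<open>
  The \<open>'k\<close>-vector space with basis \<open>B :: 'b set\<close> is the set of all finitely supported functions
  in \<open>'b \<Rightarrow>\<^sub>0 'k\<close> whose support lies in \<open>B\<close>; the basis vector \<open>b\<close> is \<open>bvec b\<close>. The tensor product of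
  the spaces with bases \<open>B\<close> and \<open>C\<close> is the space with basis \<open>B \<times> C\<close>. The product \<open>*\<close> that the
  library puts on \<open>\<Rightarrow>\<^sub>0\<close> (convolution) plays no role.
\<close>

abbreviation bvec :: "'b \<Rightarrow> ('b \<Rightarrow>\<^sub>0 'k::field)" where
  "bvec b \<equiv> Poly_Mapping.single b 1"

definition smul :: "'k::field \<Rightarrow> ('b \<Rightarrow>\<^sub>0 'k) \<Rightarrow> ('b \<Rightarrow>\<^sub>0 'k)" where
  "smul c x = Poly_Mapping.map (\<lambda>a. c * a) x"

definition span_of :: "'b set \<Rightarrow> ('b \<Rightarrow>\<^sub>0 'k::field) set" where
  "span_of B = {x. Poly_Mapping.keys x \<subseteq> B}"

text \<open>The linear map given by its values on the basis vectors.\<close>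

definition lin_ext :: "('b \<Rightarrow> ('c \<Rightarrow>\<^sub>0 'k)) \<Rightarrow> ('b \<Rightarrow>\<^sub>0 'k::field) \<Rightarrow> ('c \<Rightarrow>\<^sub>0 'k)" where
  "lin_ext g x = (\<Sum>b\<in>Poly_Mapping.keys x. smul (Poly_Mapping.lookup x b) (g b))"

definition tens :: "('b \<Rightarrow>\<^sub>0 'k::field) \<Rightarrow> ('c \<Rightarrow>\<^sub>0 'k) \<Rightarrow> ('b \<times> 'c \<Rightarrow>\<^sub>0 'k)" where
  "tens x y = (\<Sum>b\<in>Poly_Mapping.keys x. \<Sum>c\<in>Poly_Mapping.keys y.
     Poly_Mapping.single (b, c) (Poly_Mapping.lookup x b * Poly_Mapping.lookup y c))"

text \<open>The tensor product of two linear maps, both given by their values on basis vectors.\<close>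

definition tens_map ::
  "('b \<Rightarrow> ('b' \<Rightarrow>\<^sub>0 'k::field)) \<Rightarrow> ('c \<Rightarrow> ('c' \<Rightarrow>\<^sub>0 'k)) \<Rightarrow> ('b \<times> 'c \<Rightarrow>\<^sub>0 'k) \<Rightarrow> ('b' \<times> 'c' \<Rightarrow>\<^sub>0 'k)" where
  "tens_map f g = lin_ext (\<lambda>(b, c). tens (f b) (g c))"

definition assoc :: "(('a \<times> 'b) \<times> 'c \<Rightarrow>\<^sub>0 'k::field) \<Rightarrow> ('a \<times> 'b \<times> 'c \<Rightarrow>\<^sub>0 'k)" where
  "assoc = lin_ext (\<lambda>((a, b), c). bvec (a, b, c))"

lemma lookup_smul [simp]: "Poly_Mapping.lookup (smul c x) b = c * Poly_Mapping.lookup x b"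
  by (simp add: smul_def Poly_Mapping.map.rep_eq when_def)

lemma vector_space_smul: "vector_space (smul :: 'k::field \<Rightarrow> ('b \<Rightarrow>\<^sub>0 'k) \<Rightarrow> _)"
  by unfold_locales (auto intro!: poly_mapping_eqI simp: lookup_add algebra_simps)


section \<open>Gaussian binomial coefficients\<close>

definition qint :: "nat \<Rightarrow> 'k::field poly" where
  "qint l = (\<Sum>i<l. monom 1 i)"

definition qfact :: "nat \<Rightarrow> 'k::field poly" where
  "qfact l = (\<Prod>i=1..l. qint i)"

text \<open>
  The quotient is formed in the polynomial ring, where it is exact (see \<open>qfact_dvd\<close>), and then
  evaluated: at a root of unity the factorials themselves may vanish.
\<close>

definition gauss_binomial :: "nat \<Rightarrow> nat \<Rightarrow> 'k::field \<Rightarrow> 'k" where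
  "gauss_binomial l m q = poly (qfact (l + m) div (qfact l * qfact m)) q"

lemma qfact_Suc: "qfact (Suc l) = qfact l * qint (Suc l)"
  by (simp add: qfact_def)

lemma qint_add: "qint (l + m) = qint l + monom 1 l * qint m"
  by (induction m) (simp_all add: qint_def algebra_simps mult_monom)

lemma qfact_dvd: "(qfact l * qfact m :: 'k::field poly) dvd qfact (l + m)"
proof (induction "l + m" arbitrary: l m)
  case 0
  then show ?case by (simp add: qfact_def)
next
  case (Suc s)
  show ?case
  proof (cases "l = 0 \<or> m = 0")
    case True
    then show ?thesis by (auto simp: qfact_def)
  next
    case False
    then obtain l' m' where l: "l = Suc l'" and m: "m = Suc m'"
      by (metis not0_implies_Suc)
    have "(qfact l' * qfact m :: 'k poly) dvd qfact s"
      using Suc.hyps(1)[of l' m] Suc.hyps(2) by (simp add: l)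
    then have 1: "(qfact l * qfact m :: 'k poly) dvd qfact s * qint l"
      unfolding l qfact_Suc by (metis mult.assoc mult.commute mult_dvd_mono dvd_refl)
    have "(qfact l * qfact m' :: 'k poly) dvd qfact s"
      using Suc.hyps(1)[of l m'] Suc.hyps(2) by (simp add: m)
    then have 2: "(qfact l * qfact m :: 'k poly) dvd qfact s * qint m"
      unfolding m qfact_Suc by (metis mult.assoc mult_dvd_mono dvd_refl)
    have "(qfact (l + m) :: 'k poly) = qfact s * qint l + monom 1 l * (qfact s * qint m)"
      unfolding Suc.hyps(2)[symmetric] qfact_Suc
      by (simp add: Suc.hyps(2) qint_add distrib_left mult.left_commute)
    then show ?thesis
      using 1 2 by (simp add: dvd_add dvd_mult)
  qed
qed


section \<open>The Hopf algebra of the cyclic quiver\<close>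

text \<open>
  The pair \<open>(i, l)\<close> with \<open>i < n\<close> stands for the path of length \<open>l\<close> starting at the vertex \<open>i\<close>,
  where the residues modulo \<open>n\<close> are represented by \<open>0, \<dots>, n - 1\<close>. The exponent \<open>i * m\<close> in the
  multiplication is well defined on residues exactly when \<open>q ^ n = 1\<close>; the definitions below
  are meant for such \<open>q\<close>.
\<close>

type_synonym path = "nat \<times> nat"

definition paths :: "nat \<Rightarrow> path set" where
  "paths n = {0..<n} \<times> UNIV"

definition path_vec :: "nat \<Rightarrow> nat \<Rightarrow> nat \<Rightarrow> (path \<Rightarrow>\<^sub>0 'k::field)" where
  "path_vec n i l = bvec (i mod n, l)"

fun comult :: "nat \<Rightarrow> path \<Rightarrow> (path \<times> path \<Rightarrow>\<^sub>0 'k::field)" where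
  "comult n (i, l) = (\<Sum>j\<le>l. tens (path_vec n (i + j) (l - j)) (path_vec n i j))"

fun counit :: "path \<Rightarrow> 'k::field" where
  "counit (i, l) = (if l = 0 then 1 else 0)"

fun mult :: "nat \<Rightarrow> 'k::field \<Rightarrow> path \<Rightarrow> path \<Rightarrow> (path \<Rightarrow>\<^sub>0 'k)" where
  "mult n q (i, l) (j, m) = smul (q ^ (i * m) * gauss_binomial l m q) (path_vec n (i + j) (l + m))"


section \<open>Finite dimensional right comodules\<close>

text \<open>The coaction is given by its values on basis vectors.\<close>

record (overloaded) ('b, 'k::zero) comod =
  basis :: "'b set"
  coact :: "'b \<Rightarrow> ('b \<times> path \<Rightarrow>\<^sub>0 'k)"

definition fd_comodule :: "nat \<Rightarrow> ('b, 'k::field) comod \<Rightarrow> bool" where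
  "fd_comodule n V \<longleftrightarrow>
     finite (basis V) \<and>
     (\<forall>b\<in>basis V.
        coact V b \<in> span_of (basis V \<times> paths n) \<and>
        assoc (tens_map (coact V) bvec (coact V b)) = tens_map bvec (comult n) (coact V b) \<and>
        lin_ext (\<lambda>(c, h). smul (counit h) (bvec c)) (coact V b) = bvec b)"

text \<open>
  Every linear map between the underlying spaces is the restriction of a linear map between the
  ambient types.
\<close>

definition comodule_hom ::
  "('b, 'k::field) comod \<Rightarrow> ('c, 'k) comod \<Rightarrow> (('b \<Rightarrow>\<^sub>0 'k) \<Rightarrow> ('c \<Rightarrow>\<^sub>0 'k)) \<Rightarrow> bool" where
  "comodule_hom V W f \<longleftrightarrow>
     Vector_Spaces.linear smul smul f \<and>
     f ` span_of (basis V) \<subseteq> span_of (basis W) \<and>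
     (\<forall>x\<in>span_of (basis V).
        lin_ext (coact W) (f x) = tens_map (\<lambda>b. f (bvec b)) bvec (lin_ext (coact V) x))"

definition isomorphic_comodules :: "nat \<Rightarrow> ('b, 'k::field) comod \<Rightarrow> ('c, 'k) comod \<Rightarrow> bool" where
  "isomorphic_comodules n V W \<longleftrightarrow>
     fd_comodule n V \<and> fd_comodule n W \<and>
     (\<exists>f. comodule_hom V W f \<and> bij_betw f (span_of (basis V)) (span_of (basis W)))"

definition tensor_comod ::
  "nat \<Rightarrow> 'k::field \<Rightarrow> ('b, 'k) comod \<Rightarrow> ('c, 'k) comod \<Rightarrow> ('b \<times> 'c, 'k) comod" where
  "tensor_comod n q U V =
     \<lparr>basis = basis U \<times> basis V,
      coact = (\<lambda>(a, b). lin_ext (\<lambda>((a', g), (b', h)). tens (bvec (a', b')) (mult n q g h))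
                          (tens (coact U a) (coact V b)))\<rparr>"

definition direct_sum_comod ::
  "'i set \<Rightarrow> ('i \<Rightarrow> ('b, 'k::field) comod) \<Rightarrow> ('i \<times> 'b, 'k) comod" where
  "direct_sum_comod I V =
     \<lparr>basis = (SIGMA i:I. basis (V i)),
      coact = (\<lambda>(i, b). lin_ext (\<lambda>(c, h). bvec ((i, c), h)) (coact (V i) b))\<rparr>"

definition V_comod :: "nat \<Rightarrow> nat \<Rightarrow> nat \<Rightarrow> (nat, 'k::field) comod" where
  "V_comod n i l =
     \<lparr>basis = {0..l},
      coact = (\<lambda>m. \<Sum>j=m..l. tens (bvec j) (path_vec n (i + m) (j - m)))\<rparr>"

end

theory Submission
  imports Defs
begin

text \<open>
  A comodule over \<open>k Z(1)\<close> whose vertex grading is lifted to the natural numbers is a graded vector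
  space with a nilpotent operator \<open>N\<close> of degree 1, since a path of length \<open>k\<close> acts by \<open>N\<^sup>k\<close>. On a tensor
  product \<open>N\<close> is \<open>N \<otimes> 1 + 1 \<otimes> N\<close>, because at \<open>q = 1\<close> the Gaussian binomials are ordinary ones. The
  claim is therefore the Clebsch-Gordan rule: in characteristic 0 each Jordan block extends to an
  irreducible representation of \<open>sl\<^sub>2\<close>, and the tensor product has one lowest weight vector in each
  degree \<open>i \<le> min l m\<close>, generating a string of length \<open>l + m - 2i + 1\<close>. The \<open>sl\<^sub>2\<close> relations show that
  these strings are linearly independent, and the number of their elements is the dimension.
\<close>

section \<open>Linear maps given on a basis\<close>

interpretation pm: vector_space "smul :: 'k::field \<Rightarrow> ('b \<Rightarrow>\<^sub>0 'k) \<Rightarrow> _"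
  by (rule vector_space_smul)

text \<open>Any finite superset of the support is allowed, so that sums belonging to vectors with
  different supports can be compared term by term.\<close>

lemma lookup_lin_ext:
  assumes "finite B" "Poly_Mapping.keys x \<subseteq> B"
  shows "Poly_Mapping.lookup (lin_ext g x) c =
    (\<Sum>b\<in>B. Poly_Mapping.lookup x b * Poly_Mapping.lookup (g b) c)"
  unfolding lin_ext_def lookup_sum lookup_smul
  by (rule sum.mono_neutral_left) (use assms in \<open>auto simp: in_keys_iff\<close>)

lemma lin_ext_add: "lin_ext g (x + y) = lin_ext g x + lin_ext g y"
  by (rule poly_mapping_eqI)
    (use keys_add[of x y] in \<open>simp add: lookup_add sum.distrib distrib_right
      lookup_lin_ext[where B = "Poly_Mapping.keys x \<union> Poly_Mapping.keys y"]\<close>)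

lemma lin_ext_0 [simp]: "lin_ext g 0 = 0"
  by (simp add: lin_ext_def)

lemma lin_ext_smul: "lin_ext g (smul c x) = smul c (lin_ext g x)"
proof (rule poly_mapping_eqI)
  fix k
  have "Poly_Mapping.keys (smul c x) \<subseteq> Poly_Mapping.keys x"
    by (auto simp: in_keys_iff)
  then show "Poly_Mapping.lookup (lin_ext g (smul c x)) k = Poly_Mapping.lookup (smul c (lin_ext g x)) k"
    by (simp add: lookup_lin_ext[where B = "Poly_Mapping.keys x"] sum_distrib_left mult.assoc)
qed

lemma lin_ext_sum: "lin_ext g (\<Sum>i\<in>I. x i) = (\<Sum>i\<in>I. lin_ext g (x i))"
  by (induction I rule: infinite_finite_induct) (simp_all add: lin_ext_add)

lemma lin_ext_single [simp]: "lin_ext g (Poly_Mapping.single b a) = smul a (g b)"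
  by (rule poly_mapping_eqI) (simp add: lookup_lin_ext[where B = "{b}"])

lemma linear_lin_ext: "Vector_Spaces.linear smul smul (lin_ext g)"
  unfolding Vector_Spaces.linear_iff
  by (simp add: lin_ext_add lin_ext_smul vector_space_smul)

lemma lin_ext_cong: "(\<And>b. b \<in> Poly_Mapping.keys x \<Longrightarrow> g b = h b) \<Longrightarrow> lin_ext g x = lin_ext h x"
  by (simp add: lin_ext_def)

lemma lin_ext_lin_ext: "lin_ext g (lin_ext f x) = lin_ext (\<lambda>b. lin_ext g (f b)) x"
  unfolding lin_ext_def[of f] lin_ext_def[of "\<lambda>b. lin_ext g (f b)"] by (simp add: lin_ext_sum lin_ext_smul)

lemma lin_ext_bvec: "lin_ext bvec x = x"
proof (rule poly_mapping_eqI)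
  fix k
  have "Poly_Mapping.lookup (lin_ext bvec x) k =
      (\<Sum>b\<in>Poly_Mapping.keys x. if b = k then Poly_Mapping.lookup x b else 0)"
    unfolding lookup_lin_ext[OF finite_keys subset_refl]
    by (intro sum.cong) (auto simp: lookup_single when_def)
  then show "Poly_Mapping.lookup (lin_ext bvec x) k = Poly_Mapping.lookup x k"
    by (simp add: in_keys_iff)
qed

lemma lookup_tens [simp]: 
  "Poly_Mapping.lookup (tens x y) (b, c) = Poly_Mapping.lookup x b * Poly_Mapping.lookup y c"
proof -
  have "Poly_Mapping.lookup (tens x y) (b, c) = (\<Sum>b'\<in>Poly_Mapping.keys x. if b' = b then
      (\<Sum>c'\<in>Poly_Mapping.keys y. if c' = c then Poly_Mapping.lookup x b' * Poly_Mapping.lookup y c' else 0) else 0)"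
    unfolding tens_def lookup_sum by (intro sum.cong refl) (auto simp: lookup_single when_def)
  then show ?thesis by (auto simp: in_keys_iff)
qed

lemma tens_add_left: "tens (x + x') y = tens x y + tens x' y"
  by (rule poly_mapping_eqI) (auto simp: lookup_add distrib_right split: prod.splits)

lemma tens_add_right: "tens x (y + y') = tens x y + tens x y'"
  by (rule poly_mapping_eqI) (auto simp: lookup_add distrib_left)

lemma tens_0 [simp]: "tens 0 y = 0" "tens x 0 = 0"
  by (simp_all add: tens_def)

lemma tens_sum_left: "tens (\<Sum>i\<in>I. x i) y = (\<Sum>i\<in>I. tens (x i) y)"
  by (induction I rule: infinite_finite_induct) (simp_all add: tens_add_left)

lemma tens_sum_right: "tens x (\<Sum>i\<in>I. y i) = (\<Sum>i\<in>I. tens x (y i))"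
  by (induction I rule: infinite_finite_induct) (simp_all add: tens_add_right)

lemma tens_single: "tens (Poly_Mapping.single b a) (Poly_Mapping.single c d) = Poly_Mapping.single (b, c) (a * d)"
  by (rule poly_mapping_eqI) (auto simp: lookup_single when_def split: if_splits)

lemma smul_single [simp]: "smul c (Poly_Mapping.single b a) = Poly_Mapping.single b (c * a)"
  by (rule poly_mapping_eqI) (auto simp: lookup_single when_def)

lemma smul_sum: "smul c (\<Sum>i\<in>I. x i) = (\<Sum>i\<in>I. smul c (x i))"
  by (rule pm.scale_sum_right)

section \<open>Gaussian binomial coefficients at 1\<close>

lemma qint_1: "poly (qint l) (1 :: 'k::field) = of_nat l"
  by (simp add: qint_def poly_sum poly_monom)

lemma qfact_1: "poly (qfact l) (1 :: 'k::field) = of_nat (fact l)"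
  by (induction l) (simp_all add: qfact_Suc qint_1 qfact_def algebra_simps)

text \<open>The polynomial division is exact, so it may be evaluated factor by factor; at 1 the
  divisor is a product of factorials, nonzero in characteristic 0.\<close>

lemma gauss_binomial_1:
  "gauss_binomial l m (1 :: 'k::field_char_0) = of_nat (l + m choose l)"
proof -
  define g :: "'k poly" where "g = qfact (l + m) div (qfact l * qfact m)"
  have "qfact (l + m) = g * (qfact l * qfact m)"
    unfolding g_def by (simp add: qfact_dvd)
  then have "poly (qfact (l + m)) 1 = poly g 1 * (poly (qfact l) 1 * poly (qfact m) (1 :: 'k))"
    by (metis poly_mult)
  then have "of_nat (fact (l + m)) = poly g 1 * (of_nat (fact l) * of_nat (fact m) :: 'k)"
    by (simp only: qfact_1)
  then show ?thesis
    by (simp add: gauss_binomial_def g_def binomial_fact field_simps)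
qed

section \<open>Comodules with a graded basis\<close>

text \<open>
  When the basis carries a grading by \<open>nat\<close> that lifts the one by vertices, the vertex and the
  length of each path in the coaction are forced by the degrees, and a matrix \<open>A\<close> remains.
\<close>

definition graded_coaction :: "nat \<Rightarrow> 'b set \<Rightarrow> ('b \<Rightarrow> nat) \<Rightarrow> ('b \<Rightarrow> 'b \<Rightarrow> 'k::field) \<Rightarrow> 'b \<Rightarrow> ('b \<times> path \<Rightarrow>\<^sub>0 'k)" where
  "graded_coaction n B dg A b =
     (\<Sum>b'\<in>B. Poly_Mapping.single (b', (dg b mod n, dg b' - dg b)) (A b b'))"

lemma keys_sum_single:
  "Poly_Mapping.keys (\<Sum>i\<in>I. Poly_Mapping.single (f i) (a i)) \<subseteq> f ` I"
  using keys_sum[of "\<lambda>i. Poly_Mapping.single (f i) (a i)" I] by (fastforce split: if_splits)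

lemma comult_eq: "comult n (i, l) =
  (\<Sum>j\<le>l. Poly_Mapping.single ((((i + j) mod n, l - j), (i mod n, j))) 1)"
  by (simp add: path_vec_def tens_single)

text \<open>Cutting a path at length \<open>j\<close> means passing through degree
  \<open>dg b + j\<close>, so coassociativity becomes \<open>comp\<close>: \<open>A\<close> factors
  through every intermediate degree. The counit axiom comes from \<open>supp\<close> and
  \<open>diag\<close>.\<close>

lemma fd_comodule_graded:
  fixes V :: "('b, 'k::field) comod"
  assumes n: "n > 0" and fin: "finite (basis V)"
    and co: "\<And>b. b \<in> basis V \<Longrightarrow> coact V b = graded_coaction n (basis V) dg A b"
    and supp: "\<And>b b'. b \<in> basis V \<Longrightarrow> b' \<in> basis V \<Longrightarrow> A b b' \<noteq> 0 \<Longrightarrow> dg b \<le> dg b'"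
    and diag: "\<And>b b'. b \<in> basis V \<Longrightarrow> b' \<in> basis V \<Longrightarrow> dg b' = dg b \<Longrightarrow> A b b' = (if b = b' then 1 else 0)"
    and comp: "\<And>b b'' e. b \<in> basis V \<Longrightarrow> b'' \<in> basis V \<Longrightarrow> dg b \<le> e \<Longrightarrow> e \<le> dg b'' \<Longrightarrow>
       (\<Sum>b' | b' \<in> basis V \<and> dg b' = e. A b b' * A b' b'') = A b b''"
  shows "fd_comodule n V"
  unfolding fd_comodule_def
proof (intro conjI ballI fin)
  fix b assume b: "b \<in> basis V"
  let ?B = "basis V"
  show "coact V b \<in> span_of (?B \<times> paths n)"
    unfolding co[OF b] graded_coaction_def span_of_def
    using keys_sum_single n by (fastforce simp: paths_def)
  let ?S = "\<lambda>b' b'' j. Poly_Mapping.single (b'', ((dg b + j) mod n, dg b'' - dg b - j), (dg b mod n, j)) (A b b' * A b' b'')"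
  have "assoc (tens_map (coact V) bvec (coact V b)) =
      (\<Sum>b'\<in>?B. \<Sum>b''\<in>?B. Poly_Mapping.single (b'', (dg b' mod n, dg b'' - dg b'), (dg b mod n, dg b' - dg b)) (A b b' * A b' b''))"
    by (simp add: co b graded_coaction_def tens_map_def assoc_def lin_ext_sum tens_sum_left tens_single smul_sum cong: sum.cong)
  also have "\<dots> = (\<Sum>b''\<in>?B. \<Sum>b'\<in>?B. Poly_Mapping.single (b'', (dg b' mod n, dg b'' - dg b'), (dg b mod n, dg b' - dg b)) (A b b' * A b' b''))"
    by (rule sum.swap)
  also have "\<dots> = (\<Sum>b''\<in>?B. \<Sum>j\<le>dg b'' - dg b. Poly_Mapping.single (b'', ((dg b + j) mod n, dg b'' - dg b - j), (dg b mod n, j)) (A b b''))"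
  proof (rule sum.cong[OF refl])
    fix b'' assume b'': "b'' \<in> ?B"
    show "(\<Sum>b'\<in>?B. Poly_Mapping.single (b'', (dg b' mod n, dg b'' - dg b'), (dg b mod n, dg b' - dg b)) (A b b' * A b' b''))
       = (\<Sum>j\<le>dg b'' - dg b. Poly_Mapping.single (b'', ((dg b + j) mod n, dg b'' - dg b - j), (dg b mod n, j)) (A b b''))"
       (is "?l = ?r")
    proof (cases "dg b \<le> dg b''")
      case False
      then have "A b b' * A b' b'' = 0" if "b' \<in> ?B" for b'
        using supp[OF b that] supp[OF that b''] by force
      \<comment> \<open>Truncated subtraction leaves the term \<open>j = 0\<close> on the right even
        here, so its coefficient has to vanish.\<close>
      moreover have "A b b'' = 0" using False supp[OF b b''] by blast
      ultimately show ?thesis by (simp del: mult_eq_0_iff)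
    next
      case True
      let ?I = "{b'\<in>?B. dg b \<le> dg b' \<and> dg b' \<le> dg b''}"
      have "?l = (\<Sum>b'\<in>?I. ?S b' b'' (dg b' - dg b))"
      proof (rule sum.mono_neutral_cong_right)
        show "\<forall>i\<in>?B - ?I. Poly_Mapping.single (b'', (dg i mod n, dg b'' - dg i), (dg b mod n, dg i - dg b)) (A b i * A i b'') = 0"
          using supp[OF b] supp[OF _ b''] by fastforce
      qed (use fin in auto)
      \<comment> \<open>The two paths depend on \<open>b'\<close> only through its degree, so the
        sum is grouped by degree.\<close>
      also have "\<dots> = (\<Sum>j\<in>{..dg b'' - dg b}. \<Sum>b'\<in>{b'\<in>?I. dg b' - dg b = j}. ?S b' b'' (dg b' - dg b))"
        by (rule sum.group[symmetric]) (use fin in auto)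
      also have "\<dots> = (\<Sum>j\<in>{..dg b'' - dg b}. \<Sum>b' | b' \<in> ?B \<and> dg b' = dg b + j. ?S b' b'' j)"
        using True by (intro sum.cong) auto
      also have "\<dots> = (\<Sum>j\<in>{..dg b'' - dg b}. Poly_Mapping.single (b'', ((dg b + j) mod n, dg b'' - dg b - j), (dg b mod n, j))
         (\<Sum>b' | b' \<in> ?B \<and> dg b' = dg b + j. A b b' * A b' b''))"
        by (intro sum.cong refl poly_mapping_eqI) (auto simp: lookup_sum lookup_single when_def)
      also have "\<dots> = ?r"
        using True comp[OF b b''] by (intro sum.cong refl) auto
      finally show ?thesis .
    qed
  qed
  also have "\<dots> = tens_map bvec (comult n) (coact V b)"
    by (simp add: co b graded_coaction_def tens_map_def lin_ext_sum comult_eq tens_sum_right tens_single smul_sum mod_add_left_eq del: comult.simps cong: sum.cong)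
  finally show "assoc (tens_map (coact V) bvec (coact V b)) = tens_map bvec (comult n) (coact V b)" .
  have "lin_ext (\<lambda>(c, h). smul (counit h) (bvec c)) (coact V b) = 
     (\<Sum>b'\<in>?B. Poly_Mapping.single b' (if b' = b then 1 else 0))"
    unfolding co[OF b] graded_coaction_def lin_ext_sum
    by (intro sum.cong refl) (use supp[OF b] diag[OF b] in \<open>force split: if_splits\<close>)
  also have "\<dots> = (\<Sum>b'\<in>?B. if b' = b then bvec b' else 0)"
    by (intro sum.cong) auto
  finally show "lin_ext (\<lambda>(c, h). smul (counit h) (bvec c)) (coact V b) = bvec b"
    using b fin by simp
qed

section \<open>Isomorphisms from invertible intertwining matrices\<close>

text \<open>Independent rows in the right number form a basis. Expanding the unit vectors in the
  rows gives the left inverse \<open>P\<close>, and independence makes it two-sided.\<close>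

lemma matrix_inverse:
  fixes M :: "'c \<Rightarrow> 'b \<Rightarrow> 'k::field"
  assumes fin: "finite B" "finite C" and card: "card B = card C"
    and indep: "\<And>\<alpha> c. (\<And>b. b \<in> B \<Longrightarrow> (\<Sum>c\<in>C. \<alpha> c * M c b) = 0) \<Longrightarrow> c \<in> C \<Longrightarrow> \<alpha> c = 0"
  obtains P where
    "\<And>b b'. b \<in> B \<Longrightarrow> b' \<in> B \<Longrightarrow> (\<Sum>c\<in>C. P b c * M c b') = (if b = b' then 1 else 0)"
    "\<And>c c'. c \<in> C \<Longrightarrow> c' \<in> C \<Longrightarrow> (\<Sum>b\<in>B. M c b * P b c') = (if c = c' then 1 else 0)"
proof -
  define r :: "'c \<Rightarrow> ('b \<Rightarrow>\<^sub>0 'k)" where "r c = (\<Sum>b\<in>B. Poly_Mapping.single b (M c b))" for c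
  have look: "Poly_Mapping.lookup (r c) b = (if b \<in> B then M c b else 0)" for c b
    using fin by (simp add: r_def lookup_sum lookup_single when_def)
  have comb: "\<alpha> c = 0" if "(\<Sum>c\<in>C. smul (\<alpha> c) (r c)) = 0" "c \<in> C" for \<alpha> c
  proof (rule indep[OF _ that(2)])
    fix b assume "b \<in> B"
    then show "(\<Sum>c\<in>C. \<alpha> c * M c b) = 0"
      using arg_cong[OF that(1), of "\<lambda>x. Poly_Mapping.lookup x b"] by (simp add: lookup_sum look)
  qed
  \<comment> \<open>The library speaks of independent sets; injectivity rules out repeated rows and
    gives the set the right cardinality.\<close>
  have inj: "inj_on r C"
  proof (rule inj_onI, rule ccontr)
    fix c d assume cd: "c \<in> C" "d \<in> C" "r c = r d" "c \<noteq> d"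
    have "(\<Sum>e\<in>C. smul ((if e = c then 1 else 0) - (if e = d then 1 else 0)) (r e)) 
       = (\<Sum>e\<in>C. (if e = c then r c else 0) - (if e = d then r d else 0))"
      by (intro sum.cong) (auto simp: pm.scale_left_diff_distrib)
    also have "\<dots> = 0" using cd fin by (simp add: sum_subtractf)
    finally show False using comb[of "\<lambda>e. (if e = c then 1 else 0) - (if e = d then 1 else 0)" c] cd by simp
  qed
  have ind: "pm.independent (r ` C)"
  proof (rule pm.independent_if_scalars_zero)
    fix f x assume f: "(\<Sum>x\<in>r ` C. smul (f x) x) = 0" and "x \<in> r ` C"
    then obtain c where c: "x = r c" "c \<in> C" by auto
    have "(\<Sum>c\<in>C. smul (f (r c)) (r c)) = 0"
      using f by (simp add: sum.reindex[OF inj])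
    with c show "f x = 0" using comb[of "\<lambda>c. f (r c)"] by simp
  qed (use fin in auto)
  have "inj_on (bvec :: 'b \<Rightarrow> ('b \<Rightarrow>\<^sub>0 'k)) B"
    by (rule inj_onI) (metis lookup_single_eq lookup_single_not_eq zero_neq_one)
  then have cardB: "card ((bvec :: 'b \<Rightarrow> ('b \<Rightarrow>\<^sub>0 'k)) ` B) = card B" by (rule card_image)
  have sub: "r ` C \<subseteq> pm.span (bvec ` B)"
  proof safe
    fix c
    have "r c = (\<Sum>b\<in>B. smul (M c b) (bvec b))" by (simp add: r_def)
    also have "\<dots> \<in> pm.span (bvec ` B)"
      by (intro pm.span_sum pm.span_scale pm.span_base) auto
    finally show "r c \<in> pm.span (bvec ` B)" .
  qed
  obtain T where T: "card T = card B" "finite T" "r ` C \<subseteq> T" "T \<subseteq> r ` C \<union> bvec ` B"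
    using pm.exchange_lemma[OF _ ind sub] fin cardB by auto
  \<comment> \<open>A unit vector outside the span would extend the rows to more independent vectors
    than the dimension permits.\<close>
  have spanB: "bvec b \<in> pm.span (r ` C)" if "b \<in> B" for b
  proof (rule ccontr)
    assume nin: "bvec b \<notin> pm.span (r ` C)"
    then have "pm.independent (insert (bvec b) (r ` C))"
      using ind by (simp add: pm.independent_insert pm.span_base)
    moreover have "insert (bvec b) (r ` C) \<subseteq> pm.span (bvec ` B)"
      using sub that by (auto intro: pm.span_base)
    ultimately have "card (insert (bvec b) (r ` C)) \<le> card ((bvec :: 'b \<Rightarrow> ('b \<Rightarrow>\<^sub>0 'k)) ` B)"
      using pm.independent_span_bound[of "bvec ` B"] fin by blast
    moreover have "bvec b \<notin> r ` C" using nin pm.span_base by blast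
    ultimately show False using fin card cardB by (simp add: card_image[OF inj])
  qed
  have "\<exists>u. bvec b = (\<Sum>c\<in>C. smul (u c) (r c))" if b: "b \<in> B" for b
  proof -
    obtain u where "bvec b = (\<Sum>v\<in>r ` C. smul (u v) v)"
      using spanB[OF b] fin by (auto simp: pm.span_finite)
    then show ?thesis by (intro exI[of _ "u \<circ> r"]) (simp add: sum.reindex[OF inj])
  qed
  then obtain P where P: "\<And>b. b \<in> B \<Longrightarrow> bvec b = (\<Sum>c\<in>C. smul (P b c) (r c))"
    by metis
  have PM: "(\<Sum>c\<in>C. P b c * M c b') = (if b = b' then 1 else 0)" if "b \<in> B" "b' \<in> B" for b b'
    using arg_cong[OF P[OF that(1)], of "\<lambda>x. Poly_Mapping.lookup x b'"] that
    by (simp add: lookup_sum look lookup_single when_def split: if_splits)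
  have MP: "(\<Sum>b\<in>B. M c b * P b c') = (if c = c' then 1 else 0)" if "c \<in> C" "c' \<in> C" for c c'
  proof -
    \<comment> \<open>Since \<open>(M P - 1) M = M (P M) - M = 0\<close>, each row of
      \<open>M P - 1\<close> is a relation between the rows of \<open>M\<close>.\<close>
    have "(\<Sum>b\<in>B. M c b * P b c') - (if c' = c then 1 else 0) = 0"
    proof (rule indep[OF _ that(2)])
      fix b' assume b': "b' \<in> B"
      have "(\<Sum>c'\<in>C. (\<Sum>b\<in>B. M c b * P b c') * M c' b') = (\<Sum>c'\<in>C. \<Sum>b\<in>B. M c b * (P b c' * M c' b'))"
        by (simp add: sum_distrib_right mult.assoc)
      also have "\<dots> = (\<Sum>b\<in>B. \<Sum>c'\<in>C. M c b * (P b c' * M c' b'))"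
        by (rule sum.swap)
      also have "\<dots> = (\<Sum>b\<in>B. if b = b' then M c b else 0)"
        by (intro sum.cong refl) (simp add: PM b' flip: sum_distrib_left)
      also have "\<dots> = M c b'"
        using b' fin by simp
      finally have 1: "(\<Sum>c'\<in>C. (\<Sum>b\<in>B. M c b * P b c') * M c' b') = M c b'" .
      have "(\<Sum>c'\<in>C. (if c' = c then 1 else 0) * M c' b') = (\<Sum>c'\<in>C. if c' = c then M c' b' else 0)"
        by (intro sum.cong) auto
      with 1 show "(\<Sum>c'\<in>C. ((\<Sum>b\<in>B. M c b * P b c') - (if c' = c then 1 else 0)) * M c' b') = 0"
        using that fin by (simp add: left_diff_distrib sum_subtractf)
    qed
    then show ?thesis by auto
  qed
  show ?thesis by (rule that[OF PM MP])
qed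

text \<open>By \<open>deg\<close> the map given by \<open>M\<close> preserves degrees, hence paths,
  so compatibility with the coactions is the matrix identity \<open>inter\<close>;
  \<open>card\<close> and \<open>indep\<close> make \<open>M\<close> invertible.\<close>

lemma isomorphic_graded:
  fixes V :: "('b, 'k::field) comod" and W :: "('c, 'k) comod" and M :: "'b \<Rightarrow> 'c \<Rightarrow> 'k"
  assumes V: "fd_comodule n V" and W: "fd_comodule n W"
    and coV: "\<And>b. b \<in> basis V \<Longrightarrow> coact V b = graded_coaction n (basis V) dV AV b"
    and coW: "\<And>b. b \<in> basis W \<Longrightarrow> coact W b = graded_coaction n (basis W) dW AW b"
    and deg: "\<And>b c. b \<in> basis V \<Longrightarrow> c \<in> basis W \<Longrightarrow> M b c \<noteq> 0 \<Longrightarrow> dV b = dW c"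
    and inter: "\<And>b c. b \<in> basis V \<Longrightarrow> c \<in> basis W \<Longrightarrow>
      (\<Sum>c'\<in>basis W. M b c' * AW c' c) = (\<Sum>b'\<in>basis V. AV b b' * M b' c)"
    and card: "card (basis V) = card (basis W)"
    and indep: "\<And>\<alpha> c. (\<And>b. b \<in> basis V \<Longrightarrow> (\<Sum>c\<in>basis W. \<alpha> c * M b c) = 0) \<Longrightarrow> c \<in> basis W \<Longrightarrow> \<alpha> c = 0"
  shows "isomorphic_comodules n V W"
proof -
  let ?B = "basis V" and ?C = "basis W"
  have fin: "finite ?B" "finite ?C" using V W by (auto simp: fd_comodule_def)
  obtain P where P1: "\<And>b b'. b \<in> ?B \<Longrightarrow> b' \<in> ?B \<Longrightarrow> (\<Sum>c\<in>?C. P b c * M b' c) = (if b = b' then 1 else 0)"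
    and P2: "\<And>c c'. c \<in> ?C \<Longrightarrow> c' \<in> ?C \<Longrightarrow> (\<Sum>b\<in>?B. M b c * P b c') = (if c = c' then 1 else 0)"
    using matrix_inverse[of ?B ?C "\<lambda>c b. M b c"] fin card indep by blast
  define \<phi> where "\<phi> b = (\<Sum>c\<in>?C. Poly_Mapping.single c (M b c))" for b
  define \<psi> where "\<psi> c = (\<Sum>b\<in>?B. Poly_Mapping.single b (P b c))" for c
  have into: "lin_ext (\<lambda>b. \<Sum>c\<in>C. Poly_Mapping.single c (N b c)) x \<in> span_of C" if "finite C"
    for C :: "'x set" and N :: "'y \<Rightarrow> 'x \<Rightarrow> 'k" and x
    using that
    by (auto simp: span_of_def in_keys_iff lin_ext_def lookup_sum lookup_single when_def)
      (rule ccontr, simp)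
  have lphi: "lin_ext \<psi> (\<phi> b) = bvec b" if "b \<in> ?B" for b
  proof (rule poly_mapping_eqI)
    fix b'
    have "Poly_Mapping.lookup (lin_ext \<psi> (\<phi> b)) b' = (if b' \<in> ?B then \<Sum>c\<in>?C. P b' c * M b c else 0)"
      using fin by (simp add: \<phi>_def \<psi>_def lin_ext_sum lookup_sum lookup_single when_def mult.commute)
    then show "Poly_Mapping.lookup (lin_ext \<psi> (\<phi> b)) b' = Poly_Mapping.lookup (bvec b) b'"
      using that by (auto simp: P1 lookup_single when_def)
  qed
  have lpsi: "lin_ext \<phi> (\<psi> c) = bvec c" if "c \<in> ?C" for c
  proof (rule poly_mapping_eqI)
    fix c'
    have "Poly_Mapping.lookup (lin_ext \<phi> (\<psi> c)) c' = (if c' \<in> ?C then \<Sum>b\<in>?B. M b c' * P b c else 0)"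
      using fin by (simp add: \<phi>_def \<psi>_def lin_ext_sum lookup_sum lookup_single when_def mult.commute)
    then show "Poly_Mapping.lookup (lin_ext \<phi> (\<psi> c)) c' = Poly_Mapping.lookup (bvec c) c'"
      using that by (auto simp: P2 lookup_single when_def)
  qed
  have bij: "bij_betw (lin_ext \<phi>) (span_of ?B) (span_of ?C)"
  proof (rule bij_betw_byWitness[where f' = "lin_ext \<psi>"])
    show "\<forall>x\<in>span_of ?B. lin_ext \<psi> (lin_ext \<phi> x) = x"
      unfolding lin_ext_lin_ext by (auto simp: span_of_def lphi subset_iff lin_ext_bvec cong: lin_ext_cong)
    show "\<forall>x\<in>span_of ?C. lin_ext \<phi> (lin_ext \<psi> x) = x"
      unfolding lin_ext_lin_ext by (auto simp: span_of_def lpsi subset_iff lin_ext_bvec cong: lin_ext_cong)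
    show "lin_ext \<phi> ` span_of ?B \<subseteq> span_of ?C" "lin_ext \<psi> ` span_of ?C \<subseteq> span_of ?B"
      unfolding \<phi>_def \<psi>_def using into fin by auto
  qed
  have hom: "lin_ext (coact W) (\<phi> b) = tens_map \<phi> bvec (coact V b)" if b: "b \<in> ?B" for b
  proof -
    have "lin_ext (coact W) (\<phi> b) = (\<Sum>c'\<in>?C. \<Sum>c\<in>?C. Poly_Mapping.single (c, (dW c' mod n, dW c - dW c')) (M b c' * AW c' c))"
      by (simp add: \<phi>_def coW graded_coaction_def lin_ext_sum smul_sum cong: sum.cong)
    also have "\<dots> = (\<Sum>c\<in>?C. \<Sum>c'\<in>?C. Poly_Mapping.single (c, (dW c' mod n, dW c - dW c')) (M b c' * AW c' c))"
      by (rule sum.swap)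
    \<comment> \<open>Where \<open>M b c'\<close> is nonzero, \<open>c'\<close> has the degree of
      \<open>b\<close>; the path then no longer depends on \<open>c'\<close> and the coefficients
      can be collected.\<close>
    also have "\<dots> = (\<Sum>c\<in>?C. \<Sum>c'\<in>?C. Poly_Mapping.single (c, (dV b mod n, dW c - dV b)) (M b c' * AW c' c))"
    proof (intro sum.cong refl)
      fix c c' assume "c \<in> ?C" "c' \<in> ?C"
      then show "Poly_Mapping.single (c, (dW c' mod n, dW c - dW c')) (M b c' * AW c' c)
        = Poly_Mapping.single (c, (dV b mod n, dW c - dV b)) (M b c' * AW c' c)"
        using deg[OF b, of c'] by (cases "M b c' = 0") auto
    qed
    also have "\<dots> = (\<Sum>c\<in>?C. Poly_Mapping.single (c, (dV b mod n, dW c - dV b)) (\<Sum>c'\<in>?C. M b c' * AW c' c))"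
      by (intro sum.cong refl poly_mapping_eqI) (auto simp: lookup_sum lookup_single when_def)
    also have "\<dots> = (\<Sum>c\<in>?C. Poly_Mapping.single (c, (dV b mod n, dW c - dV b)) (\<Sum>b'\<in>?B. AV b b' * M b' c))"
      using inter[OF b] by simp
    also have "\<dots> = (\<Sum>c\<in>?C. \<Sum>b'\<in>?B. Poly_Mapping.single (c, (dV b mod n, dW c - dV b)) (AV b b' * M b' c))"
      by (intro sum.cong refl poly_mapping_eqI) (auto simp: lookup_sum lookup_single when_def)
    also have "\<dots> = (\<Sum>c\<in>?C. \<Sum>b'\<in>?B. Poly_Mapping.single (c, (dV b mod n, dV b' - dV b)) (AV b b' * M b' c))"
    proof (intro sum.cong refl)
      fix c b' assume "c \<in> ?C" "b' \<in> ?B"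
      then show "Poly_Mapping.single (c, (dV b mod n, dW c - dV b)) (AV b b' * M b' c)
        = Poly_Mapping.single (c, (dV b mod n, dV b' - dV b)) (AV b b' * M b' c)"
        using deg[of b' c] by (cases "M b' c = 0") auto
    qed
    also have "\<dots> = (\<Sum>b'\<in>?B. \<Sum>c\<in>?C. Poly_Mapping.single (c, (dV b mod n, dV b' - dV b)) (AV b b' * M b' c))"
      by (rule sum.swap)
    also have "\<dots> = tens_map \<phi> bvec (coact V b)"
      by (simp add: \<phi>_def coV b graded_coaction_def tens_map_def lin_ext_sum smul_sum tens_sum_left tens_single)
    finally show ?thesis .
  qed
  have "comodule_hom V W (lin_ext \<phi>)"
    unfolding comodule_hom_def
  proof (intro conjI ballI linear_lin_ext)
    show "lin_ext \<phi> ` span_of ?B \<subseteq> span_of ?C" using bij by (simp add: bij_betw_def)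
    fix x :: "'b \<Rightarrow>\<^sub>0 'k" assume "x \<in> span_of ?B"
    then have "lin_ext (\<lambda>b. lin_ext (coact W) (\<phi> b)) x = lin_ext (\<lambda>b. tens_map \<phi> bvec (coact V b)) x"
      by (intro lin_ext_cong hom) (auto simp: span_of_def)
    then show "lin_ext (coact W) (lin_ext \<phi> x) = tens_map (\<lambda>b. lin_ext \<phi> (bvec b)) bvec (lin_ext (coact V) x)"
      by (simp add: lin_ext_lin_ext tens_map_def)
  qed
  with bij V W show ?thesis unfolding isomorphic_comodules_def by blast
qed

section \<open>Strings of the nilpotent operator\<close>

text \<open>Monotone lattice paths from \<open>(a, b)\<close> to \<open>(c, d)\<close> are counted
  by their unique point \<open>(j, e - j)\<close> of degree \<open>e\<close>. The window keeps this
  point in the rectangle; the other Vandermonde terms vanish.\<close>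

lemma vandermonde_window:
  assumes "a \<le> c" "b \<le> d" "a + b \<le> e" "e \<le> c + d"
  shows "(\<Sum>j | a \<le> j \<and> j \<le> c \<and> b + j \<le> e \<and> e \<le> d + j.
      (e - (a + b) choose (j - a)) * ((c + d) - e choose (c - j))) = ((c + d) - (a + b) choose (c - a))"
    (is "sum ?f ?J = _")
proof -
  define p where "p = e - (a + b)"
  define r where "r = (c + d) - e"
  have "((c + d) - (a + b) choose (c - a)) = (p + r choose (c - a))"
    using assms by (simp add: p_def r_def)
  also have "\<dots> = (\<Sum>k\<le>c - a. (p choose k) * (r choose (c - a - k)))"
    by (rule vandermonde[symmetric])
  also have "\<dots> = (\<Sum>j\<in>{a..c}. (p choose (j - a)) * (r choose (c - j)))"
    by (rule sum.reindex_bij_witness[of _ "\<lambda>j. j - a" "\<lambda>k. k + a"]) (use assms in \<open>auto simp: add.commute\<close>)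
  also have "\<dots> = (\<Sum>j\<in>?J. (p choose (j - a)) * (r choose (c - j)))"
    by (rule sum.mono_neutral_right) (use assms in \<open>auto simp: p_def r_def not_le\<close>)
  finally show ?thesis by (simp add: p_def r_def)
qed

text \<open>Pascal's rule summed against arbitrary weights: the induction step of a binomial
  theorem.\<close>

lemma sum_choose_Suc:
  fixes T :: "nat \<Rightarrow> nat \<Rightarrow> 'k::comm_semiring_1"
  shows "(\<Sum>s\<le>Suc k. of_nat (Suc k choose s) * T s (Suc k - s))
       = (\<Sum>s\<le>k. of_nat (k choose s) * (T (Suc s) (k - s) + T s (Suc (k - s))))"
proof -
  have "(\<Sum>s\<le>Suc k. of_nat (Suc k choose s) * T s (Suc k - s))
      = T 0 (Suc k) + (\<Sum>s\<le>k. of_nat (Suc k choose Suc s) * T (Suc s) (k - s))"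
    by (subst sum.atMost_Suc_shift) simp
  also have "\<dots> = (\<Sum>s\<le>k. of_nat (k choose s) * T (Suc s) (k - s)) +
      (T 0 (Suc k) + (\<Sum>s\<le>k. of_nat (k choose Suc s) * T (Suc s) (k - s)))"
    by (simp add: sum.distrib algebra_simps)
  also have "T 0 (Suc k) + (\<Sum>s\<le>k. of_nat (k choose Suc s) * T (Suc s) (k - s)) =
      (\<Sum>s\<le>Suc k. of_nat (k choose s) * T s (Suc k - s))"
    by (subst sum.atMost_Suc_shift) simp
  also have "\<dots> = (\<Sum>s\<le>k. of_nat (k choose s) * T s (Suc (k - s)))"
    by (simp add: Suc_diff_le binomial_eq_0)
  finally show ?thesis by (simp add: sum.distrib distrib_left)
qed

text \<open>
  A function \<open>g\<close> stands for the functional \<open>v\<^sub>a \<otimes> v\<^sub>b \<mapsto> g (l - a) (m - b)\<close> on the tensor product, so that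
  \<open>raise\<close> is the transpose of the nilpotent operator \<open>v\<^sub>a \<otimes> v\<^sub>b \<mapsto> v\<^sub>a\<^sub>+\<^sub>1 \<otimes> v\<^sub>b + v\<^sub>a \<otimes> v\<^sub>b\<^sub>+\<^sub>1\<close> and \<open>lower\<close> is its
  partner in an \<open>sl\<^sub>2\<close>-triple. Only the values on the box \<open>x \<le> l\<close>, \<open>y \<le> m\<close> matter.
\<close>

definition raise :: "(nat \<Rightarrow> nat \<Rightarrow> 'k::field) \<Rightarrow> nat \<Rightarrow> nat \<Rightarrow> 'k" where
  "raise g x y = (if x = 0 then 0 else g (x - 1) y) + (if y = 0 then 0 else g x (y - 1))"

definition lower :: "nat \<Rightarrow> nat \<Rightarrow> (nat \<Rightarrow> nat \<Rightarrow> 'k::field) \<Rightarrow> nat \<Rightarrow> nat \<Rightarrow> 'k" where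
  "lower l m g x y = of_nat (x + 1) * (of_nat l - of_nat x) * g (x + 1) y
     + of_nat (y + 1) * (of_nat m - of_nat y) * g x (y + 1)"

text \<open>
  The solution, unique up to a scalar, of the two-term recursion which expresses that \<open>lower\<close>
  kills a function supported in degree \<open>i\<close>.
\<close>

definition low_wt :: "nat \<Rightarrow> nat \<Rightarrow> nat \<Rightarrow> nat \<Rightarrow> nat \<Rightarrow> 'k::field" where
  "low_wt l m i x y = (if x + y = i
     then (- 1) ^ x * of_nat (i choose x) * of_nat (fact (m - y)) * of_nat (fact (l - x)) else 0)"

text \<open>Binomial theorem for a sum of two commuting shifts. The guard replaces truncated
  subtraction by the value 0 outside the quadrant.\<close>

lemma raise_pow:
  "(raise ^^ k) g x y =
     (\<Sum>s\<le>k. of_nat (k choose s) * (if s \<le> x \<and> k - s \<le> y then g (x - s) (y - (k - s)) else 0))"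
proof (induction k arbitrary: g)
  case 0
  show ?case by simp
next
  case (Suc k)
  define T where "T s t = (if s \<le> x \<and> t \<le> y then g (x - s) (y - t) else 0)" for s t
  have "(if s \<le> x \<and> k - s \<le> y then raise g (x - s) (y - (k - s)) else 0)
      = T (Suc s) (k - s) + T s (Suc (k - s))" for s
    by (auto simp: T_def raise_def)
  then have "(raise ^^ Suc k) g x y = (\<Sum>s\<le>k. of_nat (k choose s) * (T (Suc s) (k - s) + T s (Suc (k - s))))"
    by (simp add: funpow_swap1[of raise] funpow_Suc_right Suc.IH del: funpow.simps)
  then have "(raise ^^ Suc k) g x y = (\<Sum>s\<le>Suc k. of_nat (Suc k choose s) * T s (Suc k - s))"
    by (simp only: sum_choose_Suc)
  then show ?case
    by (simp only: T_def)
qed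

lemma raise_pow_add:
  "(raise ^^ (k + j)) g x y =
     (\<Sum>s\<le>k. of_nat (k choose s) * (if s \<le> x \<and> k - s \<le> y then (raise ^^ j) g (x - s) (y - (k - s)) else 0))"
  by (simp add: funpow_add raise_pow[of k])

section \<open>The \<open>sl\<^sub>2\<close> relations and the lowest weight vectors\<close>

text \<open>The commutator relation of \<open>sl\<^sub>2\<close>: the commutator of
  \<open>lower\<close> and \<open>raise\<close> is the scalar \<open>l + m - 2 * d\<close> in degree
  \<open>d\<close>.\<close>

lemma lower_raise:
  "lower l m (raise g) x y =
     raise (lower l m g) x y + (of_nat l + of_nat m - 2 * of_nat (x + y)) * g x y"
  by (cases x; cases y) (simp_all add: lower_def raise_def algebra_simps)

lemma lower_cmult: "lower l m (\<lambda>x y. c * g x y) = (\<lambda>x y. c * lower l m g x y)"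
  by (simp add: lower_def fun_eq_iff algebra_simps)

lemma raise_cmult: "raise (\<lambda>x y. c * g x y) = (\<lambda>x y. c * raise g x y)"
  by (simp add: raise_def fun_eq_iff algebra_simps)

lemma lower_pow_cmult: "(lower l m ^^ j) (\<lambda>x y. c * g x y) = (\<lambda>x y. c * (lower l m ^^ j) g x y)"
  by (induction j) (simp_all add: lower_cmult)

lemma lower_pow_zero: "(lower l m ^^ j) (\<lambda>x y. 0) = (\<lambda>x y. 0)"
  using lower_pow_cmult[where c = 0 and g = "\<lambda>x y. 0"] by simp

lemma lower_sum: "lower l m (\<lambda>x y. \<Sum>c\<in>C. g c x y) = (\<lambda>x y. \<Sum>c\<in>C. lower l m (g c) x y)"
  by (simp add: lower_def fun_eq_iff sum_distrib_left sum.distrib)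

lemma lower_pow_sum:
  "(lower l m ^^ j) (\<lambda>x y. \<Sum>c\<in>C. g c x y) = (\<lambda>x y. \<Sum>c\<in>C. (lower l m ^^ j) (g c) x y)"
  by (induction j) (simp_all add: lower_sum)

text \<open>The coefficients \<open>l - x\<close> and \<open>m - y\<close> vanish on the boundary, so nothing leaks in from outside.\<close>

lemma lower_zero_on_box:
  assumes "\<And>x y. x \<le> l \<Longrightarrow> y \<le> m \<Longrightarrow> g x y = 0" "x \<le> l" "y \<le> m"
  shows "lower l m g x y = 0"
  using assms by (cases "x = l"; cases "y = m") (simp_all add: lower_def)

lemma lower_pow_zero_on_box:
  assumes "\<And>x y. x \<le> l \<Longrightarrow> y \<le> m \<Longrightarrow> g x y = 0" "x \<le> l" "y \<le> m"
  shows "(lower l m ^^ j) g x y = 0"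
  using assms(2,3) by (induction j arbitrary: x y) (simp_all add: assms(1) lower_zero_on_box)

lemma lower_low_wt:
  assumes "i \<le> l" "i \<le> m"
  shows "lower l m (low_wt l m i) x y = (0 :: 'k::field)"
proof (cases "x + y + 1 = i")
  case True
  \<comment> \<open>In degree \<open>i - 1\<close> both \<open>x < l\<close> and
    \<open>y < m\<close> hold, so one factor can be split off each factorial; binomial absorption
    then cancels the two terms.\<close>
  obtain p where l: "l = x + Suc p" using assms True less_imp_Suc_add[of x l] by auto
  obtain r where m: "m = y + Suc r" using assms True less_imp_Suc_add[of y m] by auto
  have "(x + 1) * (i choose (x + 1)) = (y + 1) * (i choose x)"
    using binomial_absorption[of x i] binomial_absorb_comp[of i x] True by auto
  then have ch: "of_nat (x + 1) * of_nat (i choose (x + 1)) = (of_nat (y + 1) * of_nat (i choose x) :: 'k)"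
    by (metis of_nat_mult)
  have "lower l m (low_wt l m i) x y =
      (- 1) ^ x * (of_nat (y + 1) * of_nat (i choose x) - of_nat (x + 1) * of_nat (i choose (x + 1)))
        * of_nat (Suc p) * of_nat (Suc r) * of_nat (fact r) * (of_nat (fact p) :: 'k)"
    using True by (simp add: lower_def low_wt_def l m algebra_simps)
  also have "\<dots> = 0" unfolding ch by simp
  finally show ?thesis .
qed (auto simp: lower_def low_wt_def)

lemma raise_pow_low_wt_support:
  "x + y \<noteq> i + j \<Longrightarrow> (raise ^^ j) (low_wt l m i) x y = 0"
proof (induction j arbitrary: x y)
  case 0
  then show ?case by (simp add: low_wt_def)
next
  case (Suc j)
  then show ?case by (auto simp: raise_def)
qed

text \<open>Moving \<open>lower\<close> past each \<open>raise\<close> adds up the weights of the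
  degrees \<open>i\<close> to \<open>i + j\<close>; their sum is the stated scalar.\<close>

lemma lower_raise_pow_low_wt:
  fixes x y :: nat
  assumes "i \<le> l" "i \<le> m"
  shows "lower l m ((raise ^^ Suc j) (low_wt l m i)) x y =
    of_nat (Suc j) * (of_nat (l + m) - of_nat (2 * i + j)) * ((raise ^^ j) (low_wt l m i) x y :: 'k::field)"
proof (induction j arbitrary: x y)
  case 0
  have "lower l m (low_wt l m i) = (\<lambda>x y. 0 :: 'k)"
    using assms by (simp add: fun_eq_iff lower_low_wt)
  then show ?case
    unfolding funpow.simps o_apply id_apply lower_raise
    by (cases "x + y = i") (simp_all add: raise_def low_wt_def)
next
  case (Suc j)
  have IH: "lower l m ((raise ^^ Suc j) (low_wt l m i)) =
      (\<lambda>x y. of_nat (Suc j) * (of_nat (l + m) - of_nat (2 * i + j)) * ((raise ^^ j) (low_wt l m i) x y :: 'k))"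
    by (simp add: fun_eq_iff Suc.IH del: funpow.simps)
  have "lower l m ((raise ^^ Suc (Suc j)) (low_wt l m i)) x y =
      of_nat (Suc j) * (of_nat (l + m) - of_nat (2 * i + j)) * (raise ^^ Suc j) (low_wt l m i) x y
      + (of_nat l + of_nat m - 2 * of_nat (x + y)) * ((raise ^^ Suc j) (low_wt l m i) x y :: 'k)"
    unfolding funpow.simps(2)[of "Suc j"] o_apply lower_raise IH raise_cmult by simp
  \<comment> \<open>The function lives in degree \<open>i + Suc j\<close> only, so
    \<open>x + y\<close> may be replaced by that number.\<close>
  also have "\<dots> = (of_nat (Suc j) * (of_nat (l + m) - of_nat (2 * i + j)) + (of_nat l + of_nat m - 2 * of_nat (i + Suc j)))
      * (raise ^^ Suc j) (low_wt l m i) x y"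
  proof (cases "x + y = i + Suc j")
    case True
    show ?thesis unfolding True by (rule distrib_right[symmetric])
  next
    case False
    show ?thesis unfolding raise_pow_low_wt_support[OF False] by simp
  qed
  also have "of_nat (Suc j) * (of_nat (l + m) - of_nat (2 * i + j)) + (of_nat l + of_nat m - 2 * of_nat (i + Suc j))
     = (of_nat (Suc (Suc j)) * (of_nat (l + m) - of_nat (2 * i + Suc j)) :: 'k)"
    by (simp add: algebra_simps)
  finally show ?case .
qed

text \<open>
  The power just past the end of the string is killed by \<open>lower\<close>; in its degree this relation
  first makes the entry at \<open>x = l\<close> vanish and then the others, by descent on \<open>x\<close>.
\<close>

lemma raise_pow_low_wt_vanish:
  assumes "i \<le> l" "i \<le> m" "l + m + 1 \<le> 2 * i + j" "x \<le> l" "y \<le> m"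
  shows "(raise ^^ j) (low_wt l m i) x y = (0 :: 'k::field_char_0)"
proof -
  define d where "d = l + m + 1 - 2 * i"
  define g :: "nat \<Rightarrow> nat \<Rightarrow> 'k" where "g = (raise ^^ d) (low_wt l m i)"
  have d: "d = Suc (l + m - 2 * i)" using assms by (simp add: d_def)
  have low: "lower l m g x y = 0" for x y
    unfolding g_def d lower_raise_pow_low_wt[OF assms(1,2)] using assms(1,2) by (simp flip: of_nat_add)
  have g0: "g (l - t) y = 0" if "t \<le> l" "y \<le> m" for t y
    using that
  proof (induction t arbitrary: y)
    case 0
    show ?case
    proof (cases "l + y = i + d")
      case True
      \<comment> \<open>The degree \<open>i + d = l + m + 1 - i\<close> exceeds \<open>l\<close>. At
        \<open>(l, y')\<close> the first term of \<open>lower\<close> has coefficient 0, while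
        \<open>m - y'\<close> is nonzero.\<close>
      then obtain y' where y': "y = Suc y'" using assms d by (cases y) auto
      show ?thesis
        using low[of l y'] 0 by (auto simp: lower_def y' simp flip: of_nat_Suc)
    next
      case False
      then show ?thesis by (simp add: g_def raise_pow_low_wt_support)
    qed
  next
    case (Suc t)
    show ?case
    proof (cases "l - Suc t + y = i + d")
      case True
      then obtain y' where y': "y = Suc y'" using assms d Suc.prems by (cases y) auto
      have "g (Suc (l - Suc t)) y' = 0"
        using Suc.IH[of y'] Suc.prems by (simp add: y' Suc_diff_Suc)
      then show ?thesis
        using low[of "l - Suc t" y'] Suc.prems by (auto simp: lower_def y' simp flip: of_nat_Suc)
    next
      case False
      then show ?thesis by (simp add: g_def raise_pow_low_wt_support)
    qed
  qed
  have g0': "g x y = 0" if "x \<le> l" "y \<le> m" for x y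
    using g0[of "l - x" y] that by simp
  have "j = (j - d) + d" using assms by (simp add: d_def)
  then have "(raise ^^ j) (low_wt l m i) x y = (raise ^^ (j - d)) g x y"
    unfolding g_def by (metis funpow_add o_apply)
  also have "\<dots> = 0"
    unfolding raise_pow by (rule sum.neutral) (use assms g0' in auto)
  finally show ?thesis .
qed

text \<open>Climbing a string and descending again returns a multiple of its start; in
  characteristic 0 the multiple is nonzero as long as \<open>j \<le> l + m - 2 * i\<close>.\<close>

lemma lower_pow_raise_pow:
  assumes "i \<le> l" "i \<le> m"
  shows "(lower l m ^^ j) ((raise ^^ j) (low_wt l m i)) =
    (\<lambda>x y. (\<Prod>t<j. of_nat (Suc t) * (of_nat (l + m) - of_nat (2 * i + t))) * (low_wt l m i x y :: 'k::field))"
proof (induction j)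
  case 0
  show ?case by simp
next
  case (Suc j)
  have "(lower l m ^^ Suc j) ((raise ^^ Suc j) (low_wt l m i)) =
     (lower l m ^^ j) (\<lambda>x y. of_nat (Suc j) * (of_nat (l + m) - of_nat (2 * i + j)) * ((raise ^^ j) (low_wt l m i) x y :: 'k))"
    unfolding funpow_Suc_right[of j "lower l m"] o_apply
    by (rule arg_cong[of _ _ "lower l m ^^ j"]) (simp only: fun_eq_iff lower_raise_pow_low_wt[OF assms] simp_thms)
  also have "\<dots> = (\<lambda>x y. (\<Prod>t<Suc j. of_nat (Suc t) * (of_nat (l + m) - of_nat (2 * i + t))) * (low_wt l m i x y :: 'k))"
    unfolding lower_pow_cmult Suc.IH by (simp add: fun_eq_iff algebra_simps)
  finally show ?case .
qed

lemma lower_pow_raise_pow_less: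
  assumes "i \<le> l" "i \<le> m" "j < r"
  shows "(lower l m ^^ r) ((raise ^^ j) (low_wt l m i)) = (\<lambda>x y. 0 :: 'k::field)"
proof -
  obtain p where r: "r = p + (1 + j)"
    using less_imp_Suc_add[OF assms(3)] by auto
  have "lower l m (low_wt l m i) = (\<lambda>x y. 0 :: 'k)"
    using assms by (simp add: fun_eq_iff lower_low_wt)
  then show ?thesis
    unfolding r funpow_add o_apply lower_pow_raise_pow[OF assms(1,2)]
    by (simp add: lower_cmult lower_pow_zero)
qed

text \<open>
  Applying \<open>lower ^^ j\<close>, with \<open>j\<close> the largest exponent that occurs, leaves only multiples of the
  \<open>low_wt l m i\<close>, which have different degrees.
\<close>

lemma raise_pow_independent:
  fixes \<alpha> :: "nat \<times> nat \<Rightarrow> 'k::field_char_0"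
  assumes C: "finite C" "\<And>i k. (i, k) \<in> C \<Longrightarrow> i \<le> l \<and> i \<le> m \<and> k \<le> l + m - 2 * i"
    and zero: "\<And>x y. x \<le> l \<Longrightarrow> y \<le> m \<Longrightarrow>
      (\<Sum>(i, k)\<in>C. \<alpha> (i, k) * (raise ^^ (l + m - 2 * i - k)) (low_wt l m i) x y) = 0"
    and c: "c \<in> C"
  shows "\<alpha> c = 0"
proof (rule ccontr)
  assume "\<alpha> c \<noteq> 0"
  define ht :: "nat \<times> nat \<Rightarrow> nat" where "ht = (\<lambda>(i, k). l + m - 2 * i - k)"
  define D where "D = {c\<in>C. \<alpha> c \<noteq> 0}"
  have "finite D" using C(1) by (simp add: D_def)
  have "D \<noteq> {}" using c \<open>\<alpha> c \<noteq> 0\<close> unfolding D_def by blast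
  with \<open>finite D\<close> have "Max (ht ` D) \<in> ht ` D" by (intro Max_in) auto
  then obtain c0 where c0: "c0 \<in> D" and "ht c0 = Max (ht ` D)" by auto
  then have max: "ht c \<le> ht c0" if "c \<in> D" for c
    using that \<open>finite D\<close> by simp
  obtain i0 k0 where ik: "c0 = (i0, k0)" by force
  have i0: "i0 \<le> l" "i0 \<le> m" "ht c0 \<le> l + m - 2 * i0"
    using c0 C(2) by (auto simp: D_def ik ht_def)
  define u :: "nat \<times> nat \<Rightarrow> nat \<Rightarrow> nat \<Rightarrow> 'k" where
    "u c x y = \<alpha> c * (raise ^^ ht c) (low_wt l m (fst c)) x y" for c x y
  have "(\<lambda>x y. \<Sum>c\<in>C. u c x y) x y = 0" if "x \<le> l" "y \<le> m" for x y
    using zero[OF that] by (simp add: u_def ht_def split_def)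
  \<comment> \<open>The point \<open>(0, i0)\<close> has degree \<open>i0\<close> and lies in the
    box: there \<open>low_wt l m i0\<close> is nonzero and the other lowest weight vectors
    vanish.\<close>
  then have "(lower l m ^^ ht c0) (\<lambda>x y. \<Sum>c\<in>C. u c x y) 0 i0 = 0"
    using i0 by (intro lower_pow_zero_on_box) auto
  then have "(\<Sum>c\<in>C. \<alpha> c * (lower l m ^^ ht c0) ((raise ^^ ht c) (low_wt l m (fst c))) 0 i0) = 0"
    unfolding lower_pow_sum u_def lower_pow_cmult .
  moreover have "(\<Sum>c\<in>C. \<alpha> c * (lower l m ^^ ht c0) ((raise ^^ ht c) (low_wt l m (fst c))) 0 i0)
     = (\<Sum>c\<in>{c0}. \<alpha> c * (lower l m ^^ ht c0) ((raise ^^ ht c) (low_wt l m (fst c))) 0 i0)"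
  proof (rule sum.mono_neutral_right; (intro ballI)?)
    fix c assume c: "c \<in> C - {c0}"
    then have fc: "fst c \<le> l" "fst c \<le> m" using C(2)[of "fst c" "snd c"] by auto
    show "\<alpha> c * (lower l m ^^ ht c0) ((raise ^^ ht c) (low_wt l m (fst c))) 0 i0 = 0"
    proof (cases "\<alpha> c = 0 \<or> ht c < ht c0")
      case True
      then show ?thesis by (auto simp: lower_pow_raise_pow_less[OF fc])
    next
      case False
      then have ht: "ht c = ht c0" using max[of c] c by (auto simp: D_def)
      \<comment> \<open>Indices with equal \<open>i\<close> and equal height also have equal
        \<open>k\<close>, the bound on \<open>k\<close> making the subtraction exact.\<close>
      moreover have "fst c \<noteq> i0"
        using c ht C(2)[of "fst c" "snd c"] C(2)[of i0 k0] c0 by (auto simp: ik ht_def D_def split_def prod_eq_iff)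
      ultimately show ?thesis
        by (simp add: lower_pow_raise_pow[OF fc] low_wt_def)
    qed
  qed (use C c0 in \<open>auto simp: D_def\<close>)
  moreover have "(\<Prod>t<ht c0. of_nat (Suc t) * (of_nat (l + m) - of_nat (2 * i0 + t))) \<noteq> (0 :: 'k)"
    using i0(1,2,3) by (auto simp del: of_nat_add of_nat_Suc)
  ultimately show False
    using c0 by (simp add: D_def ik lower_pow_raise_pow[OF i0(1,2)] low_wt_def)
qed

text \<open>For \<open>s = l + m\<close> and \<open>r = min l m\<close> the right side is
  \<open>(l + 1) * (m + 1)\<close>, the dimension of the tensor product.\<close>

lemma sum_string_lengths:
  "2 * r \<le> s \<Longrightarrow> (\<Sum>i\<le>r. Suc (s - 2 * i)) = (r + 1) * (s + 1 - r)"
proof (induction r)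
  case (Suc r)
  then obtain p where "s = 2 * Suc r + p" by (metis le_Suc_ex)
  with Suc show ?case by (simp add: algebra_simps)
qed simp

section \<open>The Clebsch-Gordan decomposition\<close>

text \<open>One grading serves both sides: \<open>v\<^sub>a \<otimes> v\<^sub>b\<close> has degree
  \<open>a + b\<close>, and \<open>v\<^sup>i\<^sub>k\<close> has degree \<open>i + k\<close>, which
  lifts its vertex.\<close>

abbreviation deg2 :: "nat \<times> nat \<Rightarrow> nat" where
  "deg2 \<equiv> \<lambda>(a, b). a + b"

text \<open>The matrix entries of the powers of \<open>N \<otimes> 1 + 1 \<otimes> N\<close>; they
  count monotone lattice paths.\<close>

definition tensor_coeff :: "nat \<times> nat \<Rightarrow> nat \<times> nat \<Rightarrow> 'k::field" where
  "tensor_coeff = (\<lambda>(a, b) (a', b').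
     if a \<le> a' \<and> b \<le> b' then of_nat (a' + b' - (a + b) choose (a' - a)) else 0)"

definition string_coeff :: "nat \<times> nat \<Rightarrow> nat \<times> nat \<Rightarrow> 'k::field" where
  "string_coeff = (\<lambda>(i, k) (i', k'). if i = i' \<and> k \<le> k' then 1 else 0)"

lemma basis_V_comod [simp]: "basis (V_comod n i l) = {0..l}"
  by (simp add: V_comod_def)

lemma coact_V_comod:
  "coact (V_comod n i l) m = (\<Sum>j=m..l. Poly_Mapping.single (j, ((i + m) mod n, j - m)) 1)"
  by (simp add: V_comod_def path_vec_def tens_single)

lemma basis_tensor [simp]: "basis (tensor_comod n q U V) = basis U \<times> basis V"
  by (simp add: tensor_comod_def)

lemma basis_direct_sum [simp]: "basis (direct_sum_comod I V) = (SIGMA i:I. basis (V i))"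
  by (simp add: direct_sum_comod_def)

lemma coact_tensor_V:
  assumes "a \<le> l" "b \<le> m"
  shows "coact (tensor_comod n (1 :: 'k::field_char_0) (V_comod n 0 l) (V_comod n 0 m)) (a, b) =
    graded_coaction n ({0..l} \<times> {0..m}) deg2 tensor_coeff (a, b)"
proof -
  have "coact (tensor_comod n (1 :: 'k) (V_comod n 0 l) (V_comod n 0 m)) (a, b) =
     (\<Sum>a'=a..l. \<Sum>b'=b..m. Poly_Mapping.single ((a', b'), ((a + b) mod n, a' - a + (b' - b)))
        (of_nat (a' - a + (b' - b) choose (a' - a))))"
    by (subst sum.swap) (simp add: tensor_comod_def coact_V_comod tens_sum_left tens_sum_right tens_single lin_ext_sum
        path_vec_def gauss_binomial_1 mod_add_eq)
  also have "\<dots> = (\<Sum>p\<in>{a..l} \<times> {b..m}. Poly_Mapping.single (p, ((a + b) mod n, deg2 p - (a + b)))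
        (tensor_coeff (a, b) p))"
    unfolding sum.cartesian_product
    by (intro sum.cong refl) (auto simp: tensor_coeff_def)
  also have "\<dots> = (\<Sum>p\<in>{0..l} \<times> {0..m}. Poly_Mapping.single (p, ((a + b) mod n, deg2 p - (a + b)))
        (tensor_coeff (a, b) p))"
    by (rule sum.mono_neutral_left) (auto simp: tensor_coeff_def split: if_splits)
  finally show ?thesis by (simp add: graded_coaction_def)
qed

lemma coact_direct_sum_V:
  assumes "finite I" "i \<in> I" "k \<le> L i"
  shows "coact (direct_sum_comod I (\<lambda>i. V_comod n i (L i))) (i, k) =
    (graded_coaction n (SIGMA i:I. {0..L i}) deg2 string_coeff (i, k) :: _ \<Rightarrow>\<^sub>0 'k::field)"
proof -
  have "coact (direct_sum_comod I (\<lambda>i. V_comod n i (L i))) (i, k) =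
     (\<Sum>j=k..L i. Poly_Mapping.single ((i, j), ((i + k) mod n, j - k)) (1 :: 'k))"
    by (simp add: direct_sum_comod_def coact_V_comod lin_ext_sum)
  also have "\<dots> = (\<Sum>p\<in>{i} \<times> {k..L i}. Poly_Mapping.single (p, ((i + k) mod n, deg2 p - (i + k))) (string_coeff (i, k) p))"
    by (rule sum.reindex_bij_witness[of _ snd "\<lambda>j. (i, j)"]) (auto simp: string_coeff_def)
  also have "\<dots> = (\<Sum>p\<in>(SIGMA i:I. {0..L i}). Poly_Mapping.single (p, ((i + k) mod n, deg2 p - (i + k))) (string_coeff (i, k) p))"
    by (rule sum.mono_neutral_left) (use assms in \<open>auto simp: string_coeff_def split: if_splits\<close>)
  finally show ?thesis by (simp add: graded_coaction_def)
qed

lemma fd_comodule_tensor_V: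
  assumes "n > 0"
  shows "fd_comodule n (tensor_comod n (1 :: 'k::field_char_0) (V_comod n 0 l) (V_comod n 0 m))"
proof (rule fd_comodule_graded[OF assms, where dg = deg2 and A = tensor_coeff])
  let ?T = "tensor_comod n (1 :: 'k) (V_comod n 0 l) (V_comod n 0 m)"
  fix p q e assume p: "p \<in> basis ?T" and q: "q \<in> basis ?T" and e: "deg2 p \<le> e" "e \<le> deg2 q"
  obtain a b c d where pq: "p = (a, b)" "q = (c, d)" by force
  show "(\<Sum>b' | b' \<in> basis ?T \<and> deg2 b' = e. tensor_coeff p b' * tensor_coeff b' q) = (tensor_coeff p q :: 'k)"
    (is "sum ?f ?B = _")
  proof (cases "a \<le> c \<and> b \<le> d")
    case False
    then have "?f z = 0" for z by (auto simp: pq tensor_coeff_def split: prod.splits)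
    moreover have "tensor_coeff p q = (0 :: 'k)" using False by (auto simp: pq tensor_coeff_def)
    ultimately show ?thesis by (simp del: mult_eq_0_iff)
  next
    case True
    let ?J = "{j. a \<le> j \<and> j \<le> c \<and> b + j \<le> e \<and> e \<le> d + j}"
    \<comment> \<open>Only the points \<open>(j, e - j)\<close> between \<open>p\<close> and
      \<open>q\<close> contribute, which is the window of the Vandermonde sum.\<close>
    have "sum ?f ?B = sum ?f ((\<lambda>j. (j, e - j)) ` ?J)"
    proof (rule sum.mono_neutral_right)
      show "(\<lambda>j. (j, e - j)) ` ?J \<subseteq> ?B" using p q by (auto simp: pq)
      show "\<forall>z\<in>?B - (\<lambda>j. (j, e - j)) ` ?J. ?f z = 0"
        by (auto simp: pq tensor_coeff_def image_iff)
    qed (auto simp: finite_subset[of _ "{0..l} \<times> {0..m}"])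
    also have "\<dots> = (\<Sum>j\<in>?J. ?f (j, e - j))"
      by (rule sum.reindex_cong[of "\<lambda>j. (j, e - j)"]) (auto intro: inj_onI)
    also have "\<dots> = (\<Sum>j\<in>?J. of_nat ((e - (a + b) choose (j - a)) * ((c + d) - e choose (c - j))))"
      by (intro sum.cong) (auto simp: pq tensor_coeff_def)
    also have "\<dots> = tensor_coeff p q"
      using vandermonde_window[of a c b d e] True e
      by (simp add: pq tensor_coeff_def flip: of_nat_sum del: of_nat_mult)
    finally show ?thesis .
  qed
qed (auto simp: coact_tensor_V tensor_coeff_def split: if_splits)

lemma fd_comodule_direct_sum_V:
  assumes "n > 0" "finite I"
  shows "fd_comodule n (direct_sum_comod I (\<lambda>i. V_comod n i (L i)) :: (nat \<times> nat, 'k::field) comod)"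
proof (rule fd_comodule_graded[OF assms(1), where dg = deg2 and A = string_coeff])
  let ?W = "direct_sum_comod I (\<lambda>i. V_comod n i (L i)) :: (nat \<times> nat, 'k) comod"
  show "finite (basis ?W)" using assms by simp
  fix p q e assume p: "p \<in> basis ?W" and q: "q \<in> basis ?W" and e: "deg2 p \<le> e" "e \<le> deg2 q"
  obtain i j i' k where pq: "p = (i, j)" "q = (i', k)" by force
  have fin: "finite {b' \<in> basis ?W. deg2 b' = e}" using assms by simp
  show "(\<Sum>b' | b' \<in> basis ?W \<and> deg2 b' = e. string_coeff p b' * string_coeff b' q) = (string_coeff p q :: 'k)"
    (is "sum ?f ?B = _")
  proof (cases "i = i'")
    case True
    \<comment> \<open>A single summand has at most one basis vector in each degree.\<close>
    have "sum ?f ?B = sum ?f {(i, e - i)}"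
      by (rule sum.mono_neutral_right[OF fin]) (use p q e True in \<open>auto simp: pq string_coeff_def split: if_splits\<close>)
    also have "\<dots> = string_coeff p q"
      using e True by (auto simp: pq string_coeff_def)
    finally show ?thesis .
  next
    case False
    then have "?f z = 0" for z by (auto simp: pq string_coeff_def split: prod.splits)
    moreover have "string_coeff p q = (0 :: 'k)" using False by (auto simp: pq string_coeff_def)
    ultimately show ?thesis by (simp del: mult_eq_0_iff)
  qed
qed (auto simp: coact_direct_sum_V assms string_coeff_def split: if_splits)

text \<open>
  The row \<open>(i, k)\<close> is the functional that reads off the coordinate \<open>v\<^sup>i\<^sub>k\<close>; the string runs backwards
  because transposing the nilpotent operator exchanges its ends.
\<close>

definition string_matrix :: "nat \<Rightarrow> nat \<Rightarrow> nat \<times> nat \<Rightarrow> nat \<times> nat \<Rightarrow> 'k::field" where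
  "string_matrix l m = (\<lambda>(a, b) (i, k). (raise ^^ (l + m - 2 * i - k)) (low_wt l m i) (l - a) (m - b))"

lemma string_matrix_support:
  assumes "a \<le> l" "b \<le> m" "i \<le> l" "i \<le> m" "k \<le> l + m - 2 * i" "a + b \<noteq> i + k"
  shows "string_matrix l m (a, b) (i, k) = 0"
  unfolding string_matrix_def prod.case by (rule raise_pow_low_wt_support) (use assms in linarith)

text \<open>Both sides are the same power of \<open>raise\<close> at \<open>(l - a, m - b)\<close>:
  degrees leave one term on the left, and \<open>raise_pow_add\<close> sums up the right.\<close>

lemma string_matrix_intertwines:
  assumes ab: "a \<le> l" "b \<le> m" and i: "i \<le> r" "r \<le> l" "r \<le> m" and k: "k \<le> l + m - 2 * i"
  shows "(\<Sum>c\<in>(SIGMA i:{0..r}. {0..l + m - 2 * i}). string_matrix l m (a, b) c * string_coeff c (i, k)) =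
    (\<Sum>p\<in>{0..l} \<times> {0..m}. tensor_coeff (a, b) p * (string_matrix l m p (i, k) :: 'k::field_char_0))"
    (is "?L = ?R")
proof -
  have il: "i \<le> l" "i \<le> m" using i by auto
  have L: "?L = (\<Sum>k'\<le>k. string_matrix l m (a, b) (i, k'))"
  proof -
    have "?L = (\<Sum>c\<in>{i} \<times> {..k}. string_matrix l m (a, b) c * string_coeff c (i, k))"
      by (rule sum.mono_neutral_right) (use i k in \<open>auto simp: string_coeff_def split: if_splits\<close>)
    also have "\<dots> = (\<Sum>k'\<le>k. string_matrix l m (a, b) (i, k'))"
      by (rule sum.reindex_bij_witness[of _ "\<lambda>j. (i, j)" snd]) (auto simp: string_coeff_def)
    finally show ?thesis .
  qed
  show ?thesis
  proof (cases "a + b \<le> i + k")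
    case False
    have "?L = 0" unfolding L
      by (intro sum.neutral ballI string_matrix_support) (use False ab il k in auto)
    moreover have "?R = 0"
    proof (intro sum.neutral ballI)
      fix p assume p: "p \<in> {0..l} \<times> {0..m}"
      then show "tensor_coeff (a, b) p * (string_matrix l m p (i, k) :: 'k) = 0"
        using False string_matrix_support[of "fst p" l "snd p" m i k, where 'a = 'k] il k
        by (cases p) (auto simp: tensor_coeff_def)
    qed
    ultimately show ?thesis by simp
  next
    case True
    \<comment> \<open>\<open>K\<close> is the length of the path in the coaction, and
      \<open>j\<close> the exponent in column \<open>(i, k)\<close> of the matrix.\<close>
    define K where "K = i + k - (a + b)"
    define j where "j = l + m - 2 * i - k"
    let ?g = "\<lambda>x y. (raise ^^ j) (low_wt l m i) x y :: 'k"
    let ?S = "{s. s \<le> K \<and> s \<le> l - a \<and> K - s \<le> m - b}"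
    let ?h = "\<lambda>s. (a + s, b + (K - s))"
    let ?f = "\<lambda>p. tensor_coeff (a, b) p * string_matrix l m p (i, k) :: 'k"
    have "?R = sum ?f (?h ` ?S)"
    proof (rule sum.mono_neutral_right; (intro ballI)?)
      show "?h ` ?S \<subseteq> {0..l} \<times> {0..m}" using ab by auto
      fix p assume p: "p \<in> {0..l} \<times> {0..m} - ?h ` ?S"
      obtain a' b' where ab': "p = (a', b')" by force
      show "?f p = 0"
      proof (rule ccontr)
        assume "?f p \<noteq> 0"
        then have "a \<le> a'" "b \<le> b'" "a' + b' = i + k"
          using string_matrix_support[of a' l b' m i k, where 'a = 'k] p il k
          by (auto simp: ab' tensor_coeff_def split: if_splits)
        then have "p = ?h (a' - a)" "a' - a \<in> ?S"
          using p by (auto simp: ab' K_def)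
        with p show False by blast
      qed
    qed simp
    also have "\<dots> = (\<Sum>s\<in>?S. ?f (?h s))"
      by (rule sum.reindex_cong[of ?h]) (auto intro: inj_onI)
    also have "\<dots> = (\<Sum>s\<in>?S. of_nat (K choose s) * ?g (l - a - s) (m - b - (K - s)))"
      by (intro sum.cong refl) (auto simp: tensor_coeff_def string_matrix_def j_def)
    also have "\<dots> = (\<Sum>s\<le>K. of_nat (K choose s) *
        (if s \<le> l - a \<and> K - s \<le> m - b then ?g (l - a - s) (m - b - (K - s)) else 0))"
      by (rule sum.mono_neutral_cong_left) auto
    also have "\<dots> = (raise ^^ (K + j)) (low_wt l m i) (l - a) (m - b)"
      by (rule raise_pow_add[symmetric])
    finally have R: "?R = (raise ^^ (K + j)) (low_wt l m i) (l - a) (m - b)" .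
    show ?thesis
    proof (cases "i \<le> a + b")
      case i_le: True
      have "?L = (\<Sum>k'\<in>{a + b - i}. string_matrix l m (a, b) (i, k'))"
        unfolding L
        by (rule sum.mono_neutral_right; (intro ballI string_matrix_support)?) (use True i_le ab il k in auto)
      also have "\<dots> = ?R"
        unfolding R using True i_le k il by (simp add: string_matrix_def K_def j_def)
      finally show ?thesis .
    next
      \<comment> \<open>Below degree \<open>i\<close> the string has no vector, and correspondingly
        the exponent \<open>K + j\<close> exceeds \<open>l + m - 2 * i\<close>.\<close>
      case False
      have "?L = 0" unfolding L
        by (intro sum.neutral ballI string_matrix_support) (use False ab il k in auto)
      moreover have "?R = 0" unfolding R
        by (rule raise_pow_low_wt_vanish) (use False True k il in \<open>auto simp: K_def j_def\<close>)
      ultimately show ?thesis by simp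
    qed
  qed
qed

lemma tensor_V_decomposition:
  assumes n: "n > 0" and r: "r = min l m"
  shows "isomorphic_comodules n
    (tensor_comod n (1 :: 'k::field_char_0) (V_comod n 0 l) (V_comod n 0 m))
    (direct_sum_comod {0..r} (\<lambda>i. V_comod n i (l + m - 2 * i)))"
proof (rule isomorphic_graded[OF fd_comodule_tensor_V[OF n] fd_comodule_direct_sum_V[OF n],
      where dV = deg2 and dW = deg2 and AV = tensor_coeff and AW = string_coeff and M = "string_matrix l m"])
  let ?T = "tensor_comod n (1 :: 'k) (V_comod n 0 l) (V_comod n 0 m)"
  let ?W = "direct_sum_comod {0..r} (\<lambda>i. V_comod n i (l + m - 2 * i)) :: (nat \<times> nat, 'k) comod"
  have rl: "r \<le> l" "r \<le> m" using r by auto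
  show "deg2 b = deg2 c" if "b \<in> basis ?T" "c \<in> basis ?W" "string_matrix l m b c \<noteq> (0 :: 'k)" for b c
    using that string_matrix_support[of "fst b" l "snd b" m "fst c" "snd c", where 'a = 'k] rl
    by (cases b; cases c) auto
  show "(\<Sum>c'\<in>basis ?W. string_matrix l m b c' * string_coeff c' c) =
      (\<Sum>b'\<in>basis ?T. tensor_coeff b b' * (string_matrix l m b' c :: 'k))"
    if "b \<in> basis ?T" "c \<in> basis ?W" for b c
    using that string_matrix_intertwines[of "fst b" l "snd b" m "fst c" r "snd c", where 'k = 'k] rl
    by (cases b; cases c) auto
  have "card (basis ?W) = (\<Sum>i\<le>r. Suc (l + m - 2 * i))"
    by (simp add: atMost_atLeast0)
  also have "\<dots> = (r + 1) * (l + m + 1 - r)"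
    by (rule sum_string_lengths) (use rl in simp)
  also have "\<dots> = card (basis ?T)"
    by (cases "l \<le> m") (simp_all add: r)
  finally show "card (basis ?T) = card (basis ?W)" ..
  show "\<alpha> c = 0" if "\<And>b. b \<in> basis ?T \<Longrightarrow> (\<Sum>c\<in>basis ?W. \<alpha> c * string_matrix l m b c) = 0"
    "c \<in> basis ?W" for \<alpha> :: "nat \<times> nat \<Rightarrow> 'k" and c
  proof (rule raise_pow_independent[OF _ _ _ that(2)])
    fix x y assume "x \<le> l" "y \<le> m"
    then show "(\<Sum>(i, k)\<in>basis ?W. \<alpha> (i, k) * (raise ^^ (l + m - 2 * i - k)) (low_wt l m i) x y) = 0"
      \<comment> \<open>Reflecting the box undoes the reversal built into
        \<open>string_matrix\<close>.\<close>
      using that(1)[of "(l - x, m - y)"] by (simp add: string_matrix_def split_def)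
  qed (use rl in auto)
qed (auto simp: coact_tensor_V coact_direct_sum_V)

theorem theorem3p4:
  fixes n l m :: nat
  assumes "n > 1"
  shows "(l \<le> m \<longrightarrow>
      isomorphic_comodules n
        (tensor_comod n (1 :: 'k::{alg_closed_field, field_char_0}) (V_comod n 0 l) (V_comod n 0 m))
        (direct_sum_comod {0..l} (\<lambda>i. V_comod n i (l + m - 2 * i))))
    \<and> (l > m \<longrightarrow>
      isomorphic_comodules n
        (tensor_comod n (1 :: 'k) (V_comod n 0 l) (V_comod n 0 m))
        (direct_sum_comod {0..m} (\<lambda>i. V_comod n i (l + m - 2 * i))))"
  using assms by (auto intro!: tensor_V_decomposition)

end
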